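(* Let $n\ge 1$, let $\mu_n$ be any probability distribution on the Boolean cube $I_n=\{0,1\}^n$, and let $y=(y_1,\dots,y_n)\in I_n$ be fixed. For any $t>0$, $$\int_{I_n} e^{t\left(d_H(x,y)-\mathbf{E}_{\mu_n}d_H(x,y)\right)}\,d\mu_n(x)\;\le\; e^{t^2/2}\prod_{j=2}^n\left(b_j+e^{t^2/2}\right),$$ where, for $2\le j\le n$, $$b_j:=e^{-t\mu^{(j)}(x_j\neq y_j)}\,(e^t-1)\,\lVert\epsilon_{x',y_j}\rVert_\infty .$$
   Context: $I_n=\{0,1\}^n$ and $d_H(x,y)=\sum_{i}|x_i-y_i|$ is the Hamming distance. Let $(x_1,\dots,x_n)$ be a random vector with distribution $\mu_n$. For $1\le k\le n$, $\mu_k$ denotes the joint distribution of $(x_1,\dots,x_k)$ on $I_k$, and $\mu^{(k)}$ denotes the distribution of the single variable $x_k$ on $\{0,1\}$; thus $\mu^{(k)}(x_k\neq y_k)$ is the marginal probability that $x_k\ne y_k$. Expectations are over $x$, with $y$ fixed. For $2\le j\le n$, $x'=(x_1,\dots,x_{j-1})\in I_{j-1}$ and $y_j\in\{0,1\}$, define $\epsilon_{x',y_j}$ by $$\mu(x_j=y_j\mid x_1,\dots,x_{j-1})=\mu^{(j)}(x_j=y_j)+\epsilon_{x',y_j},$$ where the left side is the conditional probability under $\mu_n$. The norm $\lVert\epsilon_{x',y_j}\rVert_\infty$ is the supremum of $|\epsilon_{x',y_j}|$ over $x'\in I_{j-1}$ (with $y_j$ fixed), taken over those $x'$ with $\mu_{j-1}(x')>0$,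 i.e. where the conditional probability is defined. An empty product equals $1$. *)

theory Defs
  imports "HOL-Probability.Probability"
begin

text \<open>Coordinates are indexed from 1; a point of the cube is extensional, i.e. it takes the
  value \<^term>\<open>undefined\<close> outside \<^term>\<open>{1..n}\<close>.\<close>

definition cube :: "nat \<Rightarrow> (nat \<Rightarrow> int) set" where
  "cube n = ({1..n} \<rightarrow>\<^sub>E {0, 1})"

definition hamming :: "nat \<Rightarrow> (nat \<Rightarrow> int) \<Rightarrow> (nat \<Rightarrow> int) \<Rightarrow> int" where
  "hamming n x y = (\<Sum>i = 1..n. \<bar>x i - y i\<bar>)"

definition initial_marginal :: "(nat \<Rightarrow> int) pmf \<Rightarrow> nat \<Rightarrow> (nat \<Rightarrow> int) pmf" where
  "initial_marginal \<mu> k = map_pmf (\<lambda>x. restrict x {1..k}) \<mu>"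

definition coord_marginal :: "(nat \<Rightarrow> int) pmf \<Rightarrow> nat \<Rightarrow> int pmf" where
  "coord_marginal \<mu> j = map_pmf (\<lambda>x. x j) \<mu>"

text \<open>The deviation is meaningful only when \<open>x'\<close> has positive probability under
  \<^term>\<open>initial_marginal \<mu> (j - 1)\<close>; elsewhere \<^const>\<open>cond_prob\<close> divides by zero.
  The supremum in \<open>deviation_norm\<close> is accordingly taken over such \<open>x'\<close> only, and these
  form a nonempty finite set when \<open>\<mu>\<close> is supported on \<^term>\<open>cube n\<close> and
  \<^term>\<open>1 \<le> j \<and> j \<le> n\<close>.\<close>

definition deviation :: "(nat \<Rightarrow> int) pmf \<Rightarrow> nat \<Rightarrow> (nat \<Rightarrow> int) \<Rightarrow> int \<Rightarrow> real" where
  "deviation \<mu> j x' c =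
     cond_prob (measure_pmf \<mu>) (\<lambda>x. x j = c) (\<lambda>x. restrict x {1..j - 1} = x')
       - measure_pmf.prob (coord_marginal \<mu> j) {c}"

definition deviation_norm :: "(nat \<Rightarrow> int) pmf \<Rightarrow> nat \<Rightarrow> int \<Rightarrow> real" where
  "deviation_norm \<mu> j c =
     (SUP x' \<in> {x' \<in> cube (j - 1). pmf (initial_marginal \<mu> (j - 1)) x' > 0}.
        \<bar>deviation \<mu> j x' c\<bar>)"

definition dependence_coeff :: "(nat \<Rightarrow> int) pmf \<Rightarrow> (nat \<Rightarrow> int) \<Rightarrow> real \<Rightarrow> nat \<Rightarrow> real" where
  "dependence_coeff \<mu> y t j =
     exp (- t * measure_pmf.prob (coord_marginal \<mu> j) {c. c \<noteq> y j})
       * (exp t - 1) * deviation_norm \<mu> j (y j)"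

end

theory Submission
  imports Defs
begin

text \<open>
  Condition on the first \<open>j - 1\<close> coordinates. Writing \<open>p\<close> for the marginal probability of
  \<open>x j \<noteq> y j\<close>, the conditional expectation of \<open>exp (t * (\<bar>x j - y j\<bar> - p))\<close> is the
  centred moment generating function of a Bernoulli variable, at most \<open>exp (t\<^sup>2 / 2)\<close> by
  Hoeffding's lemma, plus \<open>exp (- t * p) * (1 - exp t)\<close> times the deviation, which is at most
  the dependence coefficient. Peeling off the last coordinate repeatedly gives the product.
\<close>

text \<open>The centred Bernoulli case of Hoeffding's lemma, moved from its logarithmic form to a
  product form.\<close>

lemma bernoulli_mgf_le:
  fixes t p :: real
  assumes "t \<ge> 0" "p \<ge> 0"
  shows "exp (- t * p) * (1 - p + p * exp t) \<le> exp (t\<^sup>2 / 2)"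
proof -
  have "0 < 1 + p * (exp t - 1)"
    using assms by (intro add_pos_nonneg mult_nonneg_nonneg) auto
  then have "exp (- t * p) * (1 - p + p * exp t)
      = exp (- t * p + ln (1 + p * (exp t - 1)))"
    unfolding exp_add by (simp add: algebra_simps)
  also have "\<dots> \<le> exp (t\<^sup>2 / 8)"
    using Hoeffdings_lemma_aux[OF assms] by simp
  \<comment> \<open>The sharper constant \<open>1/8\<close> is relaxed here to the
    \<open>1/2\<close> of the final bound.\<close>
  also have "\<dots> \<le> exp (t\<^sup>2 / 2)"
    by simp
  finally show ?thesis .
qed

lemma expectation_sum_fibres:
  fixes h :: "'a \<Rightarrow> real"
  assumes fin: "finite (set_pmf M)"
  shows "measure_pmf.expectation M h =
    (\<Sum>z\<in>r ` set_pmf M. measure_pmf.expectation M (\<lambda>x. h x * indicator {x. r x = z} x))"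
proof -
  have "measure_pmf.expectation M h = measure_pmf.expectation M
      (\<lambda>x. \<Sum>z\<in>r ` set_pmf M. h x * indicator {x. r x = z} x)"
  proof (intro integral_cong_AE, simp, simp, subst AE_measure_pmf_iff, rule ballI)
    fix x assume x: "x \<in> set_pmf M"
    have "(\<Sum>z\<in>r ` set_pmf M. h x * indicator {x. r x = z} x)
        = (\<Sum>z\<in>r ` set_pmf M. if r x = z then h x else 0)"
      by (intro sum.cong) auto
    also have "\<dots> = h x"
      using x fin by simp
    finally show "h x = (\<Sum>z\<in>r ` set_pmf M. h x * indicator {x. r x = z} x)"
      by simp
  qed
  also have "\<dots> = (\<Sum>z\<in>r ` set_pmf M.
      measure_pmf.expectation M (\<lambda>x. h x * indicator {x. r x = z} x))"
    by (intro Bochner_Integration.integral_sum integrable_measure_pmf_finite fin)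
  finally show ?thesis .
qed

text \<open>A tower property without conditional expectations: \<open>f (r x)\<close> is constant on
  each fibre of \<open>r\<close>, so it acts as a nonnegative weight on the fibrewise bounds for
  \<open>g\<close>, which are then summed. Scaling \<open>C\<close> by the mass of the fibre avoids
  dividing by it.\<close>

lemma expectation_mult_le_of_fibre_le:
  fixes f :: "'b \<Rightarrow> real" and g :: "'a \<Rightarrow> real"
  assumes fin: "finite (set_pmf M)"
    and nonneg: "\<And>z. f z \<ge> 0"
    and fibre: "\<And>w. w \<in> set_pmf M \<Longrightarrow>
      measure_pmf.expectation M (\<lambda>x. g x * indicator {x. r x = r w} x)
        \<le> C * measure_pmf.prob M {x. r x = r w}"
  shows "measure_pmf.expectation M (\<lambda>x. f (r x) * g x)
    \<le> C * measure_pmf.expectation M (\<lambda>x. f (r x))"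
proof -
  have "measure_pmf.expectation M (\<lambda>x. f (r x) * g x) = (\<Sum>z\<in>r ` set_pmf M.
      f z * measure_pmf.expectation M (\<lambda>x. g x * indicator {x. r x = z} x))"
    unfolding expectation_sum_fibres[OF fin, of "\<lambda>x. f (r x) * g x" r]
      integral_mult_right_zero[symmetric]
    by (intro sum.cong Bochner_Integration.integral_cong refl) (auto simp: indicator_def)
  also have "\<dots> \<le> (\<Sum>z\<in>r ` set_pmf M. f z * (C * measure_pmf.prob M {x. r x = z}))"
    using fibre by (intro sum_mono mult_left_mono nonneg) auto
  also have "\<dots> = C * (\<Sum>z\<in>r ` set_pmf M.
      measure_pmf.expectation M (\<lambda>x. f z * indicator {x. r x = z} x))"
    by (simp add: sum_distrib_left mult_ac)
  also have "\<dots> = C * measure_pmf.expectation M (\<lambda>x. f (r x))"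
    unfolding expectation_sum_fibres[OF fin, of "\<lambda>x. f (r x)" r]
    by (intro arg_cong[where f = "(*) C"] sum.cong Bochner_Integration.integral_cong refl)
      (auto simp: indicator_def)
  finally show ?thesis .
qed

lemma finite_cube: "finite (cube n)"
  by (auto simp: cube_def intro: finite_PiE)

lemma abs_diff_eq_if_cube:
  assumes "x \<in> cube n" "y \<in> cube n" "j \<in> {1..n}"
  shows "\<bar>x j - y j\<bar> = (if x j = y j then 0 else 1)"
proof -
  have "x j \<in> {0, 1}" "y j \<in> {0, 1}"
    using assms unfolding cube_def by (blast dest: PiE_mem)+
  then show ?thesis by auto
qed

lemma prob_coord_marginal:
  "measure_pmf.prob (coord_marginal \<mu> j) A = measure_pmf.prob \<mu> {x. x j \<in> A}"
  by (simp add: coord_marginal_def vimage_def)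

lemma prob_coord_marginal_eq:
  "measure_pmf.prob (coord_marginal \<mu> j) {c}
    = 1 - measure_pmf.prob (coord_marginal \<mu> j) {b. b \<noteq> c}"
proof -
  have "{c} = - {b. b \<noteq> c}" by auto
  then show ?thesis
    using measure_pmf.prob_compl[of "{b. b \<noteq> c}" "coord_marginal \<mu> j"]
    by (simp add: Compl_eq_Diff_UNIV)
qed

lemma pmf_initial_marginal:
  "pmf (initial_marginal \<mu> k) x' = measure_pmf.prob \<mu> {x. restrict x {1..k} = x'}"
  by (simp add: initial_marginal_def pmf_map vimage_def)

text \<open>A prefix of a support point has positive probability, so it competes in the supremum,
  which is over a finite set and hence bounded.\<close>

lemma abs_deviation_le_norm:
  assumes sub: "set_pmf \<mu> \<subseteq> cube n" and w: "w \<in> set_pmf \<mu>" and "j \<le> n"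
  shows "\<bar>deviation \<mu> j (restrict w {1..j - 1}) c\<bar> \<le> deviation_norm \<mu> j c"
  unfolding deviation_norm_def
proof (rule cSUP_upper)
  have "w \<in> cube n" using sub w by blast
  then have "restrict w {1..j - 1} \<in> cube (j - 1)"
    using \<open>j \<le> n\<close> unfolding cube_def by (fastforce simp: PiE_def)
  moreover have "restrict w {1..j - 1} \<in> set_pmf (initial_marginal \<mu> (j - 1))"
    using w by (simp add: initial_marginal_def)
  ultimately show "restrict w {1..j - 1}
      \<in> {x' \<in> cube (j - 1). pmf (initial_marginal \<mu> (j - 1)) x' > 0}"
    by (simp add: pmf_positive)
  show "bdd_above ((\<lambda>x'. \<bar>deviation \<mu> j x' c\<bar>) `
      {x' \<in> cube (j - 1). pmf (initial_marginal \<mu> (j - 1)) x' > 0})"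
    by (intro bdd_above_finite finite_imageI finite_subset[OF _ finite_cube]) auto
qed

text \<open>On the support the exponential takes only two values, according to whether
  \<open>x j\<close> agrees with \<open>y j\<close>. The set \<open>Q\<close> is a prefix fibre in
  the conditioned bound and \<open>UNIV\<close> in the unconditioned one.\<close>

lemma expectation_exp_coord:
  fixes Q :: "(nat \<Rightarrow> int) set" and s t :: real
  assumes sub: "set_pmf \<mu> \<subseteq> cube n" and y: "y \<in> cube n" and j: "j \<in> {1..n}"
  shows "measure_pmf.expectation \<mu>
      (\<lambda>x. exp (t * (real_of_int \<bar>x j - y j\<bar> - s)) * indicator Q x)
    = exp (- t * s) * (measure_pmf.prob \<mu> {x. x j = y j \<and> x \<in> Q}
        + exp t * (measure_pmf.prob \<mu> Q - measure_pmf.prob \<mu> {x. x j = y j \<and> x \<in> Q}))"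
proof -
  let ?A = "{x. x j = y j \<and> x \<in> Q}"
  have "measure_pmf.expectation \<mu>
      (\<lambda>x. exp (t * (real_of_int \<bar>x j - y j\<bar> - s)) * indicator Q x)
    = measure_pmf.expectation \<mu> (\<lambda>x. exp (- t * s)
        * (indicator ?A x + exp t * (indicator Q x - indicator ?A x)))"
  proof (intro integral_cong_AE, simp, simp, subst AE_measure_pmf_iff, rule ballI)
    fix x assume "x \<in> set_pmf \<mu>"
    then have "\<bar>x j - y j\<bar> = (if x j = y j then 0 else 1)"
      using sub y j by (intro abs_diff_eq_if_cube) auto
    then show "exp (t * (real_of_int \<bar>x j - y j\<bar> - s)) * indicator Q x
        = exp (- t * s) * (indicator ?A x + exp t * (indicator Q x - indicator ?A x))"
      by (auto simp: indicator_def algebra_simps simp flip: exp_add)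
  qed
  also have "\<dots> = exp (- t * s) * (measure_pmf.prob \<mu> ?A
      + exp t * (measure_pmf.prob \<mu> Q - measure_pmf.prob \<mu> ?A))"
    using finite_subset[OF sub finite_cube]
    by (simp add: integrable_measure_pmf_finite)
  finally show ?thesis .
qed

lemma expectation_exp_coord_fibre_le:
  fixes t :: real
  defines "p \<equiv> \<lambda>\<mu> y j. measure_pmf.prob (coord_marginal \<mu> j) {c. c \<noteq> y j}"
  assumes sub: "set_pmf \<mu> \<subseteq> cube n" and y: "y \<in> cube n" and j: "j \<in> {1..n}"
    and t: "t > 0" and w: "w \<in> set_pmf \<mu>"
  shows "measure_pmf.expectation \<mu>
      (\<lambda>x. exp (t * (real_of_int \<bar>x j - y j\<bar> - p \<mu> y j))
        * indicator {x. restrict x {1..j - 1} = restrict w {1..j - 1}} x)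
    \<le> (dependence_coeff \<mu> y t j + exp (t\<^sup>2 / 2))
        * measure_pmf.prob \<mu> {x. restrict x {1..j - 1} = restrict w {1..j - 1}}"
proof -
  let ?x' = "restrict w {1..j - 1}"
  let ?Q = "{x. restrict x {1..j - 1} = ?x'}"
  let ?q = "p \<mu> y j"
  let ?d = "deviation \<mu> j ?x' (y j)"
  define a where "a = measure_pmf.prob \<mu> {x. x j = y j \<and> x \<in> ?Q}"
  have Q: "measure_pmf.prob \<mu> ?Q > 0"
    using w by (intro measure_pmf_posI[of w]) auto
  have "?d = a / measure_pmf.prob \<mu> ?Q - (1 - ?q)"
    unfolding deviation_def cond_prob_def prob_coord_marginal_eq p_def a_def by simp
  \<comment> \<open>Given the prefix, \<open>x j\<close> agrees with \<open>y j\<close> with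
    probability \<open>1 - ?q + ?d\<close> and differs with probability
    \<open>?q - ?d\<close>.\<close>
  then have a: "a = (1 - ?q + ?d) * measure_pmf.prob \<mu> ?Q"
    using Q by (simp add: field_simps)
  \<comment> \<open>A deviation \<open>?d\<close> shifts that much mass from the value
    \<open>exp t\<close> to the value \<open>1\<close>, so it enters with a minus sign;
    \<open>- ?d\<close> is at most its absolute value.\<close>
  have "exp (- t * ?q) * (exp t - 1) * - ?d \<le> dependence_coeff \<mu> y t j"
    unfolding dependence_coeff_def p_def
    using abs_deviation_le_norm[OF sub w, of j "y j"] j t
    by (intro mult_left_mono mult_nonneg_nonneg) auto
  moreover have "exp (- t * ?q) * (1 - ?q + ?q * exp t) \<le> exp (t\<^sup>2 / 2)"
    using t by (intro bernoulli_mgf_le) (auto simp: p_def)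
  ultimately have "exp (- t * ?q) * (1 - ?q + ?d + exp t * (?q - ?d))
      \<le> dependence_coeff \<mu> y t j + exp (t\<^sup>2 / 2)"
    by (simp add: algebra_simps)
  from mult_right_mono[OF this less_imp_le[OF Q]] show ?thesis
    unfolding expectation_exp_coord[OF sub y j] a_def[symmetric] a
    by (simp add: algebra_simps)
qed

text \<open>The unconditioned bound, which serves the first coordinate: it has no predecessors and
  so contributes a factor without a dependence coefficient.\<close>

lemma expectation_exp_coord_le:
  fixes t :: real
  assumes sub: "set_pmf \<mu> \<subseteq> cube n" and y: "y \<in> cube n" and j: "j \<in> {1..n}"
    and t: "t > 0"
  shows "measure_pmf.expectation \<mu> (\<lambda>x. exp (t * (real_of_int \<bar>x j - y j\<bar>
      - measure_pmf.prob (coord_marginal \<mu> j) {c. c \<noteq> y j}))) \<le> exp (t\<^sup>2 / 2)"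
proof -
  let ?q = "measure_pmf.prob (coord_marginal \<mu> j) {c. c \<noteq> y j}"
  have "measure_pmf.prob \<mu> {x. x j = y j} = 1 - ?q"
    using prob_coord_marginal_eq[of \<mu> j "y j"] prob_coord_marginal[of \<mu> j "{y j}"] by simp
  then have "measure_pmf.expectation \<mu>
      (\<lambda>x. exp (t * (real_of_int \<bar>x j - y j\<bar> - ?q))) = exp (- t * ?q) * (1 - ?q + ?q * exp t)"
    using expectation_exp_coord[OF sub y j, of t ?q UNIV] by (simp add: mult.commute)
  also have "\<dots> \<le> exp (t\<^sup>2 / 2)"
    using t by (intro bernoulli_mgf_le) auto
  finally show ?thesis .
qed

text \<open>By linearity, the centring of the Hamming distance splits into the centrings of the
  single coordinates.\<close>

lemma expectation_hamming:
  assumes sub: "set_pmf \<mu> \<subseteq> cube n" and y: "y \<in> cube n"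
  shows "measure_pmf.expectation \<mu> (\<lambda>x. real_of_int (hamming n x y))
    = (\<Sum>i = 1..n. measure_pmf.prob (coord_marginal \<mu> i) {c. c \<noteq> y i})"
proof -
  have "measure_pmf.expectation \<mu> (\<lambda>x. real_of_int (hamming n x y))
      = measure_pmf.expectation \<mu> (\<lambda>x. \<Sum>i = 1..n. indicator {x. x i \<noteq> y i} x)"
  proof (intro integral_cong_AE, simp, simp, subst AE_measure_pmf_iff, rule ballI)
    fix x assume "x \<in> set_pmf \<mu>"
    then have "\<bar>x i - y i\<bar> = (if x i = y i then 0 else 1)" if "i \<in> {1..n}" for i
      using sub y that by (intro abs_diff_eq_if_cube) auto
    then show "real_of_int (hamming n x y) = (\<Sum>i = 1..n. indicator {x. x i \<noteq> y i} x)"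
      unfolding hamming_def of_int_sum by (intro sum.cong) auto
  qed
  also have "\<dots> = (\<Sum>i = 1..n. measure_pmf.prob \<mu> {x. x i \<noteq> y i})"
    using finite_subset[OF sub finite_cube]
    by (subst Bochner_Integration.integral_sum) (auto intro: integrable_measure_pmf_finite)
  finally show ?thesis
    by (simp add: prob_coord_marginal)
qed

text \<open>The measure stays \<open>\<mu>\<close> on the full cube throughout the induction; only
  the integrand is cut down to the first \<open>k\<close> coordinates, so no passage to the
  marginals is needed. The base \<open>k = 1\<close> has an empty product.\<close>

lemma expectation_exp_partial_sum_le:
  fixes t :: real
  defines "p \<equiv> \<lambda>\<mu> y j. measure_pmf.prob (coord_marginal \<mu> j) {c. c \<noteq> y j}"
  assumes sub: "set_pmf \<mu> \<subseteq> cube n" and y: "y \<in> cube n" and t: "t > 0"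
    and k: "1 \<le> k" "k \<le> n"
  shows "measure_pmf.expectation \<mu>
      (\<lambda>x. exp (t * (\<Sum>i = 1..k. real_of_int \<bar>x i - y i\<bar> - p \<mu> y i)))
    \<le> exp (t\<^sup>2 / 2) * (\<Prod>j = 2..k. dependence_coeff \<mu> y t j + exp (t\<^sup>2 / 2))"
  using k
proof (induction k rule: nat_induct_at_least)
  case base
  then show ?case
    using expectation_exp_coord_le[OF sub y, of 1 t] t by (simp add: p_def)
next
  case (Suc k)
  let ?f = "\<lambda>x. exp (t * (\<Sum>i = 1..k. real_of_int \<bar>x i - y i\<bar> - p \<mu> y i))"
  let ?g = "\<lambda>x. exp (t * (real_of_int \<bar>x (Suc k) - y (Suc k)\<bar> - p \<mu> y (Suc k)))"
  let ?r = "\<lambda>x::nat \<Rightarrow> int. restrict x {1..k}"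
  let ?C = "dependence_coeff \<mu> y t (Suc k) + exp (t\<^sup>2 / 2)"
  have j: "Suc k \<in> {1..n}" using Suc by simp
  \<comment> \<open>Only the coordinates in \<open>{1..k}\<close> enter \<open>?f\<close>, so it
    factors through the restriction and is constant on prefix fibres.\<close>
  have f: "?f (?r x) = ?f x" for x
    by simp
  \<comment> \<open>Any support point makes the norm an upper bound of some absolute value, hence
    nonnegative. The sign of \<open>?C\<close> is needed to multiply the induction hypothesis by
    it.\<close>
  obtain w where "w \<in> set_pmf \<mu>"
    using set_pmf_not_empty by fast
  from abs_deviation_le_norm[OF sub this, of "Suc k" "y (Suc k)"] j
  have "deviation_norm \<mu> (Suc k) (y (Suc k)) \<ge> 0" by force
  then have C: "?C \<ge> 0"
    using t by (simp add: dependence_coeff_def)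
  have "measure_pmf.expectation \<mu>
      (\<lambda>x. exp (t * (\<Sum>i = 1..Suc k. real_of_int \<bar>x i - y i\<bar> - p \<mu> y i)))
    = measure_pmf.expectation \<mu> (\<lambda>x. ?f (?r x) * ?g x)"
    unfolding f by (simp add: distrib_left exp_add)
  also have "\<dots> \<le> ?C * measure_pmf.expectation \<mu> (\<lambda>x. ?f (?r x))"
  proof (rule expectation_mult_le_of_fibre_le[where f = ?f and r = ?r and g = ?g])
    fix w assume "w \<in> set_pmf \<mu>"
    from expectation_exp_coord_fibre_le[OF sub y j t this]
    show "measure_pmf.expectation \<mu> (\<lambda>x. ?g x * indicator {x. ?r x = ?r w} x)
        \<le> ?C * measure_pmf.prob \<mu> {x. ?r x = ?r w}"
      by (simp add: p_def)
  qed (use finite_subset[OF sub finite_cube] in auto)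
  also have "\<dots> \<le> ?C * (exp (t\<^sup>2 / 2)
      * (\<Prod>j = 2..k. dependence_coeff \<mu> y t j + exp (t\<^sup>2 / 2)))"
    unfolding f using Suc by (intro mult_left_mono C) auto
  also have "\<dots> = exp (t\<^sup>2 / 2)
      * (\<Prod>j = 2..Suc k. dependence_coeff \<mu> y t j + exp (t\<^sup>2 / 2))"
    using Suc by (simp add: prod.nat_ivl_Suc' mult_ac)
  finally show ?case .
qed

theorem theorem6:
  fixes n :: nat and \<mu> :: "(nat \<Rightarrow> int) pmf" and y :: "nat \<Rightarrow> int" and t :: real
  assumes "n \<ge> 1"
    and "set_pmf \<mu> \<subseteq> cube n"
    and "y \<in> cube n"
    and "t > 0"
  shows "measure_pmf.expectation \<mu>
           (\<lambda>x. exp (t * (real_of_int (hamming n x y)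
                  - measure_pmf.expectation \<mu> (\<lambda>z. real_of_int (hamming n z y)))))
         \<le> exp (t\<^sup>2 / 2) * (\<Prod>j = 2..n. dependence_coeff \<mu> y t j + exp (t\<^sup>2 / 2))"
  \<comment> \<open>For \<open>k = n\<close> the partial sum is the whole centred Hamming
    distance.\<close>
  using expectation_exp_partial_sum_le[OF assms(2,3,4,1) order_refl]
  unfolding expectation_hamming[OF assms(2,3)]
  by (simp add: hamming_def sum_subtractf)

end
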